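(* Let $p\in(0,\infty)$, let $x\in\Sigma$, and let $\ell_j$ ($j\ge1$), $m_j$ ($j\ge0$) be the lengths of the blocks of zeros and of ones in the block decomposition of $x$. Let $\Phi_1,\Psi_1:\mathbb N\to(0,\infty)$ be the functions associated with $p$ and $x$. Then the following hold. (i) There are $a_1,a_2>0$ such that, for all $n\in\mathbb N$, $$a_1\Phi_1(n)\le\sum_{k=1}^n\frac1{f^{k-1}(x)^p}\le a_2\Psi_1(n).$$ (ii) The following statements (a), (b), (c) and (d) are equivalent. (a) There is $L>0$ such that, for all $j\in\mathbb N$ with $j\ge2$, $$\frac{m_j}{\sum_{u=1}^j2^{p\ell_u}+\sum_{u=1}^{j-1}m_u}\le L.$$ (b) There is $a>0$ such that $\Psi_1(n)\le a\,\Phi_1(n)$ for all $n\in\mathbb N$. (c) There are $b_1,b_2>0$ such that, for all $n\in\mathbb N$, $$b_1\Phi_1(n)\le\sum_{k=1}^n\frac1{f^{k-1}(x)^p}\le b_2\Phi_1(n).$$ (d) There are $c_1,c_2>0$ such that, for all $n\in\mathbb N$, $$c_1\Psi_1(n)\le\sum_{k=1}^n\frac1{f^{k-1}(x)^p}\le c_2\Psi_1(n).$$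
   Context: $\mathbb N=\{1,2,3,\dots\}$. The map $f:[0,1)\to[0,1)$ is $f(x)=2x$ if $0\le x<1/2$ and $f(x)=2x-1$ if $1/2\le x<1$; $f^k$ is the $k$-fold composition, $f^0(x)=x$. $\Sigma$ is the set of $x\in[0,1)$ that are not binary rationals (a binary rational is $0$ or a number $k/2^n$ with $k,n\in\mathbb N$, $1\le k<2^n$). Each $x\in\Sigma$ has a unique binary expansion $x=\sum_{k\ge1}d_k/2^k$, $d_k\in\{0,1\}$, and its digits are neither eventually all $0$ nor eventually all $1$. Block decomposition: for $x\in\Sigma$ the digit sequence $d_1d_2d_3\dots$ is written uniquely as juxtaposed finite blocks $C_0B_1C_1B_2C_2\cdots$, where each $B_j$ ($j\ge1$) is a non-empty block of zeros, each $C_j$ ($j\ge1$) is a non-empty block of ones, and $C_0$ is a (possibly empty) block of ones. Let $\ell_j\ge1$ be the length of $B_j$ ($j\ge1$) and $m_j$ the length of $C_j$ ($j\ge0$), so $m_j\ge1$ for $j\ge1$ and $m_0\ge0$. Let $J_j\subset\mathbb N$ be the set of positions occupied by $B_j$ and $K_j$ the set of positions occupied by $C_j$: with $s_0=0$, $t_0=m_0$, $s_j=t_{j-1}+\ell_j$, $t_j=s_j+m_j$ for $j\ge1$, one has $J_j=\{t_{j-1}+1,\dots,s_j\}$ for $j\ge 1$ and $K_j=\{s_j+1,\dots,t_j\}$ for $j\ge0$ ($K_0=\emptyset$ if $C_0$ is empty). The sets $K_0,J_1,K_1,J_2,K_2,\dots$ partition $\mathbb N$. Definition of $\Phi_1,\Psi_1$: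 if $n\in K_0\cup J_1\cup K_1$, $\Phi_1(n)=\Psi_1(n)=1$. If $n\in J_j$ with $j\ge2$, $\Phi_1(n)=\Psi_1(n)=\sum_{u=1}^j2^{p\ell_u}+\sum_{u=1}^{j-1}m_u$. If $n\in K_j$ with $j\ge2$, $\Phi_1(n)=\sum_{u=1}^j2^{p\ell_u}+\sum_{u=1}^{j-1}m_u$ and $\Psi_1(n)=\sum_{u=1}^j2^{p\ell_u}+\sum_{u=1}^{j}m_u$. *)

theory Defs
  imports "HOL-Analysis.Analysis"
begin

text \<open>
  The doubling map is only of interest on the interval from 0 (included) to 1 (excluded), which it
  maps into itself; its values elsewhere are irrelevant.
\<close>

definition doubling :: "real \<Rightarrow> real" where
  "doubling x = (if x < 1/2 then 2 * x else 2 * x - 1)"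

definition binary_rationals :: "real set" where
  "binary_rationals = insert 0 {real k / 2 ^ n | k n :: nat. 1 \<le> n \<and> 1 \<le> k \<and> k < 2 ^ n}"

definition Sigma_set :: "real set" where
  "Sigma_set = {0..<1} - binary_rationals"

text \<open>Digits are indexed from 1; the value \<open>d 0\<close> is unused.\<close>

definition binary_expansion :: "(nat \<Rightarrow> nat) \<Rightarrow> real \<Rightarrow> bool" where
  "binary_expansion d x \<longleftrightarrow>
     (\<forall>k\<ge>1. d k \<in> {0, 1}) \<and> (\<lambda>k. real (d (Suc k)) / 2 ^ Suc k) sums x"

text \<open>
  \<open>l j\<close> (for \<open>j \<ge> 1\<close>) is the length of the \<open>j\<close>-th block of zeros and \<open>m j\<close> (for \<open>j \<ge> 0\<close>) the length
  of the \<open>j\<close>-th block of ones; \<open>l 0\<close> is unused. The end positions satisfy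
  \<open>s 0 = 0\<close>, \<open>t 0 = m 0\<close>, and, for \<open>j \<ge> 1\<close>, \<open>s j = t (j - 1) + l j\<close> and \<open>t j = s j + m j\<close>.
\<close>

fun zeros_end :: "(nat \<Rightarrow> nat) \<Rightarrow> (nat \<Rightarrow> nat) \<Rightarrow> nat \<Rightarrow> nat"
  and ones_end :: "(nat \<Rightarrow> nat) \<Rightarrow> (nat \<Rightarrow> nat) \<Rightarrow> nat \<Rightarrow> nat" where
  "zeros_end l m 0 = 0"
| "zeros_end l m (Suc j) = ones_end l m j + l (Suc j)"
| "ones_end l m j = zeros_end l m j + m j"

definition zeros_block :: "(nat \<Rightarrow> nat) \<Rightarrow> (nat \<Rightarrow> nat) \<Rightarrow> nat \<Rightarrow> nat set" where
  "zeros_block l m j = {ones_end l m (j - 1) + 1 .. zeros_end l m j}"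

definition ones_block :: "(nat \<Rightarrow> nat) \<Rightarrow> (nat \<Rightarrow> nat) \<Rightarrow> nat \<Rightarrow> nat set" where
  "ones_block l m j = {zeros_end l m j + 1 .. ones_end l m j}"

definition block_lengths :: "real \<Rightarrow> (nat \<Rightarrow> nat) \<Rightarrow> (nat \<Rightarrow> nat) \<Rightarrow> bool" where
  "block_lengths x l m \<longleftrightarrow>
     (\<forall>j\<ge>1. l j \<ge> 1 \<and> m j \<ge> 1) \<and>
     (\<exists>d. binary_expansion d x \<and>
        (\<forall>j\<ge>1. \<forall>n \<in> zeros_block l m j. d n = 0) \<and>
        (\<forall>j. \<forall>n \<in> ones_block l m j. d n = 1))"

text \<open>
  The block decomposition of a point that is not a binary rational exists, so \<open>block_lengths\<close> is a
  satisfiable condition for every such point.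
\<close>

lemma Sigma_set_not_dyadic:
  assumes "x \<in> Sigma_set"
  shows "x \<noteq> real k / 2 ^ n"
proof
  assume x: "x = real k / 2 ^ n"
  have x01: "0 \<le> x" "x < 1" "x \<noteq> 0" and nb: "x \<notin> binary_rationals"
    using assms by (auto simp: Sigma_set_def binary_rationals_def)
  have xx: "x = real (2 * k) / 2 ^ Suc n" using x by simp
  have "real (2 * k) < 2 ^ Suc n" using x01 unfolding xx by (simp add: field_simps)
  then have "2 * k < 2 ^ Suc n" by (metis of_nat_less_numeral_power_cancel_iff)
  moreover have "1 \<le> 2 * k" using x01 x by (cases k) auto
  ultimately have "x \<in> binary_rationals"
    unfolding binary_rationals_def xx
    by (intro insertI2 CollectI exI[of _ "2 * k"] exI[of _ "Suc n"]) auto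
  with nb show False by blast
qed

lemma binary_expansion_exists:
  assumes x: "x \<in> Sigma_set"
  obtains d where "binary_expansion d x" "\<And>n. \<exists>k\<ge>n. d (Suc k) = 0" "\<And>n. \<exists>k\<ge>n. d (Suc k) = 1"
proof -
  define F where "F = (\<lambda>n. nat \<lfloor>2 ^ n * x\<rfloor>)"
  define d where "d = (\<lambda>n. F n - 2 * F (n - 1))"
  have x01: "0 \<le> x" "x < 1" using x by (auto simp: Sigma_set_def)
  have F: "real (F n) \<le> 2 ^ n * x" "2 ^ n * x < real (F n) + 1" for n
    using x01 unfolding F_def by (auto simp: of_nat_nat)
  have F0: "F 0 = 0" using F[of 0] x01 by simp
  have "real (2 * F n) < real (F (Suc n) + 1)" "real (F (Suc n)) < real (2 * F n + 2)" for n
    using F[of n] F[of "Suc n"] by auto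
  then have dF: "F (Suc n) = 2 * F n + d (Suc n)" "d (Suc n) \<in> {0, 1}" for n
    unfolding of_nat_less_iff d_def
    by (smt (verit) One_nat_def Suc_1 add.commute add_diff_inverse_nat add_Suc_right diff_Suc_1
        insert_iff less_Suc_eq less_Suc_eq_le less_one not_less plus_1_eq_Suc add_diff_cancel_left'
        diff_self_eq_0 add.right_neutral)+
  have ps: "(\<Sum>k<n. real (d (Suc k)) / 2 ^ Suc k) = real (F n) / 2 ^ n" for n
    by (induction n) (auto simp: F0 dF(1) field_simps)
  have lim: "(\<lambda>n. real (F n) / 2 ^ n) \<longlonglongrightarrow> x"
  proof (rule real_tendsto_sandwich)
    show "(\<lambda>n. x - (1/2) ^ n) \<longlonglongrightarrow> x"
      using tendsto_diff[OF tendsto_const[of x] LIMSEQ_realpow_zero[of "1/2"]] by simp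
    show "\<forall>\<^sub>F n in sequentially. x - (1/2) ^ n \<le> real (F n) / 2 ^ n"
    proof (intro always_eventually allI)
      fix n
      have "x \<le> (real (F n) + 1) / 2 ^ n"
        using F(2)[of n] by (simp add: pos_le_divide_eq mult.commute)
      then show "x - (1/2) ^ n \<le> real (F n) / 2 ^ n"
        by (simp add: add_divide_distrib power_one_over)
    qed
    show "\<forall>\<^sub>F n in sequentially. real (F n) / 2 ^ n \<le> x"
      using F(1) by (intro always_eventually) (simp add: field_simps)
  qed auto
  have be: "binary_expansion d x"
    unfolding binary_expansion_def sums_def ps
  proof (intro conjI allI impI lim)
    fix k :: nat assume "1 \<le> k" then show "d k \<in> {0, 1}" using dF(2)[of "k - 1"] by simp
  qed
  have z: "\<exists>k\<ge>n. d (Suc k) = 0" for n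
  proof (rule ccontr)
    assume "\<not> (\<exists>k\<ge>n. d (Suc k) = 0)"
    then have "d (Suc k) = 1" if "k \<ge> n" for k using that dF(2)[of k] by auto
    then have "real (F (n + i)) + 1 = 2 ^ i * (real (F n) + 1)" for i
      by (induction i) (auto simp: dF(1) algebra_simps)
    then have c: "real (F (n + i)) = 2 ^ i * (real (F n) + 1) - 1" for i
      by (metis add_diff_cancel_right')
    have e: "real (F (n + i)) / 2 ^ (n + i) = real (F n + 1) / 2 ^ n - (1/2)^n * (1/2) ^ i" for i
      unfolding c by (simp add: field_simps power_add)
    have "(\<lambda>i. real (F (n + i)) / 2 ^ (n + i)) \<longlonglongrightarrow> real (F n + 1) / 2 ^ n - (1/2)^n * 0"
      unfolding e by (intro tendsto_intros LIMSEQ_realpow_zero) auto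
    moreover have "(\<lambda>i. real (F (n + i)) / 2 ^ (n + i)) \<longlonglongrightarrow> x"
      using LIMSEQ_ignore_initial_segment[OF lim, of n] by (simp add: add.commute)
    ultimately have "x = real (F n + 1) / 2 ^ n" using LIMSEQ_unique by fastforce
    then show False using Sigma_set_not_dyadic[OF x] by blast
  qed
  have o: "\<exists>k\<ge>n. d (Suc k) = 1" for n
  proof (rule ccontr)
    assume "\<not> (\<exists>k\<ge>n. d (Suc k) = 1)"
    then have "d (Suc k) = 0" if "k \<ge> n" for k using that dF(2)[of k] by auto
    then have "real (F (n + i)) = 2 ^ i * real (F n)" for i
      by (induction i) (auto simp: dF(1) algebra_simps)
    then have e: "real (F (n + i)) / 2 ^ (n + i) = real (F n) / 2 ^ n" for i
      by (simp add: field_simps power_add)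
    have "(\<lambda>i. real (F (n + i)) / 2 ^ (n + i)) \<longlonglongrightarrow> x"
      using LIMSEQ_ignore_initial_segment[OF lim, of n] by (simp add: add.commute)
    then have "x = real (F n) / 2 ^ n" unfolding e using LIMSEQ_unique tendsto_const by blast
    then show False using Sigma_set_not_dyadic[OF x] by blast
  qed
  show thesis using that be z o by blast
qed

lemma block_lengths_exists:
  assumes "x \<in> Sigma_set"
  obtains l m where "block_lengths x l m"
proof -
  obtain d where d: "binary_expansion d x"
    and z: "\<And>n. \<exists>k\<ge>n. d (Suc k) = 0" and o: "\<And>n. \<exists>k\<ge>n. d (Suc k) = 1"
    using binary_expansion_exists[OF assms] by metis
  define Z where "Z = (\<lambda>n. LEAST k. k \<ge> n \<and> d (Suc k) = 0)"
  define W where "W = (\<lambda>n. LEAST k. k \<ge> n \<and> d (Suc k) = 1)"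
  have Z: "Z n \<ge> n" "d (Suc (Z n)) = 0" for n
    unfolding Z_def using LeastI_ex[OF z[of n]] by auto
  have W: "W n \<ge> n" "d (Suc (W n)) = 1" for n
    unfolding W_def using LeastI_ex[OF o[of n]] by auto
  have d01: "d (Suc k) = 0 \<or> d (Suc k) = 1" for k
    using d unfolding binary_expansion_def by (metis One_nat_def insert_iff le_add1 plus_1_eq_Suc singletonD)
  have Z1: "d (Suc k) = 1" if "n \<le> k" "k < Z n" for n k
    using not_less_Least[OF that(2)[unfolded Z_def]] that(1) d01 by blast
  have W0: "d (Suc k) = 0" if "n \<le> k" "k < W n" for n k
    using not_less_Least[OF that(2)[unfolded W_def]] that(1) d01 by blast
  define T where "T = rec_nat (Z 0) (\<lambda>_ t. Z (W t))"
  have T: "T 0 = Z 0" "T (Suc j) = Z (W (T j))" for j by (simp_all add: T_def)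
  define S where "S = (\<lambda>j. case j of 0 \<Rightarrow> 0 | Suc i \<Rightarrow> W (T i))"
  have S: "S 0 = 0" "S (Suc j) = W (T j)" for j by (simp_all add: S_def)
  have TZ: "T j = Z (S j)" for j by (cases j) (auto simp: T S)
  have dT: "d (Suc (T j)) = 0" for j using Z(2) TZ by simp
  have "T j \<noteq> W (T j)" "W (T j) \<noteq> Z (W (T j))" for j
    using dT[of j] W(2)[of "T j"] Z(2)[of "W (T j)"] by (metis zero_neq_one)+
  then have lt: "T j < S (Suc j)" "S (Suc j) < T (Suc j)" for j
    using W(1)[of "T j"] Z(1)[of "W (T j)"] unfolding S T by (simp_all add: le_neq_implies_less)
  define l where "l = (\<lambda>j. S j - T (j - 1))"
  define m where "m = (\<lambda>j. T j - S j)"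
  have ze: "zeros_end l m j = S j" for j
    by (induction j) (use lt in \<open>auto simp: S(1) l_def m_def TZ Z(1) less_imp_le\<close>)
  have oe: "ones_end l m j = T j" for j
    using Z(1)[of "S j"] by (simp add: ze) (simp add: m_def TZ)
  have "block_lengths x l m"
    unfolding block_lengths_def
  proof (intro conjI exI[of _ d] allI ballI impI d)
    fix j :: nat assume "1 \<le> j"
    then obtain i where "j = Suc i" by (cases j) auto
    then show "1 \<le> l j" "1 \<le> m j" using lt[of i] by (auto simp: l_def m_def)
  next
    fix j n :: nat assume j: "1 \<le> j" and n: "n \<in> zeros_block l m j"
    obtain i where ji: "j = Suc i" using j by (cases j) auto
    show "d n = 0" using n W0[of "T i" "n - 1"]
      unfolding zeros_block_def ji ze oe by (auto simp: S(2))
  next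
    fix j n :: nat assume n: "n \<in> ones_block l m j"
    show "d n = 1" using n Z1[of "S j" "n - 1"]
      unfolding ones_block_def ze oe by (auto simp: TZ)
  qed
  then show thesis using that by blast
qed

text \<open>
  The functions \<open>\<Phi>\<^sub>1\<close> and \<open>\<Psi>\<^sub>1\<close>. The blocks partition the positive integers, so the index of the
  block containing a given position is unique; the values at \<open>n = 0\<close> are irrelevant.
\<close>

definition block_index :: "(nat \<Rightarrow> nat) \<Rightarrow> (nat \<Rightarrow> nat) \<Rightarrow> nat \<Rightarrow> nat" where
  "block_index l m n = (THE j. 1 \<le> j \<and> n \<in> zeros_block l m j \<union> ones_block l m j)"

definition Phi1 :: "real \<Rightarrow> (nat \<Rightarrow> nat) \<Rightarrow> (nat \<Rightarrow> nat) \<Rightarrow> nat \<Rightarrow> real" where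
  "Phi1 p l m n =
     (if n \<in> ones_block l m 0 \<union> zeros_block l m 1 \<union> ones_block l m 1 then 1
      else let j = block_index l m n in
        (\<Sum>u=1..j. 2 powr (p * real (l u))) + (\<Sum>u=1..j-1. real (m u)))"

definition Psi1 :: "real \<Rightarrow> (nat \<Rightarrow> nat) \<Rightarrow> (nat \<Rightarrow> nat) \<Rightarrow> nat \<Rightarrow> real" where
  "Psi1 p l m n =
     (if n \<in> ones_block l m 0 \<union> zeros_block l m 1 \<union> ones_block l m 1 then 1
      else let j = block_index l m n in
        (\<Sum>u=1..j. 2 powr (p * real (l u))) +
        (if n \<in> zeros_block l m j then \<Sum>u=1..j-1. real (m u) else \<Sum>u=1..j. real (m u)))"

definition orbit_sum :: "real \<Rightarrow> real \<Rightarrow> nat \<Rightarrow> real" where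
  "orbit_sum p x n = (\<Sum>k=1..n. 1 / ((doubling ^^ (k - 1)) x) powr p)"

end

theory Submission
  imports Defs
begin

text \<open>
  A term of the orbit sum at a position carrying the digit 1 lies between \<open>1\<close> and \<open>2 powr p\<close>, while
  inside a block of zeros the orbit doubles at every step, so the terms form, up to the factor
  \<open>2 powr p\<close>, a decreasing geometric progression dominated by its first term. Hence a block of zeros
  of length \<open>l\<close> contributes about \<open>2 powr (p * l)\<close>, already at its first position, and a block of
  ones contributes about its length. At the end of a block of ones the sum is
  therefore of the order of \<open>\<Psi>\<^sub>1\<close>, and at its first position of the order of \<open>\<Phi>\<^sub>1\<close>; comparing the two
  at these positions gives the equivalences.
\<close>

section \<open>Binary digits under the doubling map and the size of a single orbit term\<close>

lemma doubling_Sigma_set: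
  assumes "x \<in> Sigma_set"
  shows "doubling x \<in> Sigma_set"
proof -
  have x: "0 \<le> x" "x < 1" using assms by (auto simp: Sigma_set_def)
  have "doubling x \<noteq> real k / 2 ^ n" for k n
  proof
    assume "doubling x = real k / 2 ^ n"
    \<comment> \<open>Both branches of the map pull a dyadic number back to a dyadic number.\<close>
    then have "x = real k / 2 ^ Suc n \<or> x = real (k + 2 ^ n) / 2 ^ Suc n"
      by (auto simp: doubling_def field_simps split: if_splits)
    then show False using Sigma_set_not_dyadic[OF assms] by blast
  qed
  from this[of 0] this have "doubling x \<notin> binary_rationals"
    unfolding binary_rationals_def by auto
  then show ?thesis using x by (auto simp: Sigma_set_def doubling_def)
qed

lemma Sigma_set_bounds:
  assumes "x \<in> Sigma_set"
  shows "0 < x" "x < 1" "x \<noteq> 1 / 2"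
  using assms Sigma_set_not_dyadic[OF assms, of 0 0] Sigma_set_not_dyadic[OF assms, of 1 1]
  by (auto simp: Sigma_set_def)

text \<open>The tail series has sum \<open>2 * x - d 1\<close> and lies between the zero series and
  the geometric series with sum 1. The inequalities are strict because 1/2 is a binary
  rational.\<close>

lemma
  assumes "binary_expansion d x" "x \<in> Sigma_set"
  shows binary_expansion_first_0: "d 1 = 0 \<Longrightarrow> x < 1 / 2"
    and binary_expansion_first_1: "d 1 = 1 \<Longrightarrow> 1 / 2 < x"
    and binary_expansion_doubling: "binary_expansion (\<lambda>k. d (Suc k)) (doubling x)"
proof -
  have d01: "d (Suc k) \<in> {0, 1}" for k using assms(1) by (auto simp: binary_expansion_def)
  have sm: "(\<lambda>k. real (d (Suc k)) / 2 ^ Suc k) sums x"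
    using assms(1) by (auto simp: binary_expansion_def)
  have "(\<lambda>k. real (d (Suc (Suc k))) / 2 ^ Suc (Suc k)) sums (x - real (d 1) / 2)"
    using sums_split_initial_segment[OF sm, of 1] by simp
  from sums_mult[OF this, of 2]
  have tl: "(\<lambda>k. real (d (Suc (Suc k))) / 2 ^ Suc k) sums (2 * x - real (d 1))"
    by (simp add: algebra_simps)
  have le: "real (d (Suc (Suc k))) / 2 ^ Suc k \<le> (1 / 2) ^ Suc k" for k
    using d01[of "Suc k"] by (auto simp: power_divide)
  have "2 * x - real (d 1) \<le> 1"
    by (rule sums_le[OF le tl power_half_series])
  moreover have "0 \<le> 2 * x - real (d 1)"
    by (rule sums_le[OF _ sums_zero tl]) simp
  ultimately show a: "d 1 = 0 \<Longrightarrow> x < 1 / 2" "d 1 = 1 \<Longrightarrow> 1 / 2 < x"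
    using Sigma_set_bounds[OF assms(2)] by (auto simp: order_less_le)
  have "doubling x = 2 * x - real (d 1)"
    using a d01[of 0] by (auto simp: doubling_def)
  then show "binary_expansion (\<lambda>k. d (Suc k)) (doubling x)"
    unfolding binary_expansion_def using tl d01 by auto
qed

lemma orbit_Sigma_set: "x \<in> Sigma_set \<Longrightarrow> (doubling ^^ k) x \<in> Sigma_set"
  by (induction k) (auto simp: doubling_Sigma_set)

lemma orbit_binary_expansion:
  assumes "binary_expansion d x" "x \<in> Sigma_set"
  shows "binary_expansion (\<lambda>i. d (i + k)) ((doubling ^^ k) x)"
proof (induction k)
  case (Suc k)
  then show ?case
    using binary_expansion_doubling[OF Suc orbit_Sigma_set[OF assms(2)]] by simp
qed (use assms in simp)

lemma orbit_zero_run: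
  assumes "binary_expansion d x" "x \<in> Sigma_set" "\<forall>i<r. d (Suc (k + i)) = 0"
  shows "(doubling ^^ (k + r)) x = 2 ^ r * (doubling ^^ k) x"
  using assms(3)
proof (induction r)
  case (Suc r)
  have "(doubling ^^ (k + r)) x < 1 / 2"
    using binary_expansion_first_0[OF orbit_binary_expansion[OF assms(1,2), of "k + r"]
        orbit_Sigma_set[OF assms(2)]] Suc.prems by simp
  then show ?case using Suc by (simp add: doubling_def)
qed simp

text \<open>After the \<open>r\<close> zeros the orbit is at a point \<open>y\<close> in (1/2, 1),
  and each zero only doubled it, so the point at time \<open>k\<close> is \<open>y / 2 ^ r\<close>.
  The factor \<open>1 / y powr p\<close> lies between 1 and \<open>2 powr p\<close>. The case
  \<open>r = 0\<close> treats positions with digit 1.\<close>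

lemma orbit_term_bounds:
  assumes "binary_expansion d x" "x \<in> Sigma_set" "0 < p"
    and "\<forall>i<r. d (Suc (k + i)) = 0" "d (Suc (k + r)) = 1"
  shows "2 powr (p * real r) \<le> 1 / ((doubling ^^ k) x) powr p"
    and "1 / ((doubling ^^ k) x) powr p \<le> 2 powr p * 2 powr (p * real r)"
proof -
  define y where "y = (doubling ^^ (k + r)) x"
  have yS: "y \<in> Sigma_set" unfolding y_def by (rule orbit_Sigma_set[OF assms(2)])
  have "1 / 2 < y"
    using binary_expansion_first_1[OF orbit_binary_expansion[OF assms(1,2), of "k + r"]
        orbit_Sigma_set[OF assms(2)]] assms(5) by (simp add: y_def)
  with Sigma_set_bounds(2)[OF yS] have y: "1 / 2 < y" "y < 1" by auto
  have "(doubling ^^ k) x = y / 2 powr real r"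
    using orbit_zero_run[OF assms(1,2,4)] by (simp add: y_def powr_realpow)
  then have A: "((doubling ^^ k) x) powr p = y powr p / 2 powr (p * real r)"
    by (simp only: powr_divide powr_powr mult.commute)
  have eq: "1 / ((doubling ^^ k) x) powr p = 2 powr (p * real r) * (1 / y powr p)"
    unfolding A by simp
  have "y powr p \<le> 1" using y assms(3) powr_le1 by simp
  moreover have "(1 / 2) powr p \<le> y powr p" using y assms(3) by (intro powr_mono2) auto
  ultimately have u: "1 \<le> 1 / y powr p" "1 / y powr p \<le> 2 powr p"
    using y by (auto simp: powr_divide field_simps)
  show "2 powr (p * real r) \<le> 1 / ((doubling ^^ k) x) powr p"
    unfolding eq using mult_left_mono[OF u(1), of "2 powr (p * real r)"] by simp
  show "1 / ((doubling ^^ k) x) powr p \<le> 2 powr p * 2 powr (p * real r)"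
    unfolding eq using mult_right_mono[OF u(2), of "2 powr (p * real r)"]
    by (simp add: mult.commute)
qed

section \<open>Orbit sums over runs of equal digits\<close>

lemma orbit_sum_Suc: "orbit_sum p x (Suc n) = orbit_sum p x n + 1 / ((doubling ^^ n) x) powr p"
  by (simp add: orbit_sum_def)

lemma orbit_sum_mono: "n \<le> n' \<Longrightarrow> orbit_sum p x n \<le> orbit_sum p x n'"
  unfolding orbit_sum_def by (intro sum_mono2) auto

lemma orbit_sum_one_run:
  assumes "binary_expansion d x" "x \<in> Sigma_set" "0 < p" "\<forall>i<r. d (Suc (k + i)) = 1"
  shows "orbit_sum p x k + real r \<le> orbit_sum p x (k + r)"
    and "orbit_sum p x (k + r) \<le> orbit_sum p x k + 2 powr p * real r"
proof -
  have "orbit_sum p x k + real r \<le> orbit_sum p x (k + r) \<and>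
      orbit_sum p x (k + r) \<le> orbit_sum p x k + 2 powr p * real r"
    using assms(4)
  proof (induction r)
    case (Suc r)
    \<comment> \<open>With no leading zeros, each added term lies between 1 and
      \<open>2 powr p\<close>.\<close>
    from orbit_term_bounds[OF assms(1-3), of 0 "k + r"] Suc show ?case
      by (simp add: orbit_sum_Suc algebra_simps)
  qed simp
  then show "orbit_sum p x k + real r \<le> orbit_sum p x (k + r)"
    "orbit_sum p x (k + r) \<le> orbit_sum p x k + 2 powr p * real r" by auto
qed

text \<open>The first factor is the loss in a single term; the second is the sum of the geometric
  series with ratio \<open>2 powr (- p)\<close>.\<close>

definition zero_run_const :: "real \<Rightarrow> real" where
  "zero_run_const p = 2 powr p * (2 powr p / (2 powr p - 1))"

lemma zero_run_const_ge:
  assumes "0 < p"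
  shows "2 powr p \<le> zero_run_const p" "1 \<le> zero_run_const p"
proof -
  have q: "1 < 2 powr p" using assms by simp
  then have "1 \<le> 2 powr p / (2 powr p - 1)" by (simp add: field_simps)
  then show "2 powr p \<le> zero_run_const p"
    using mult_left_mono[of 1 "2 powr p / (2 powr p - 1)" "2 powr p"]
    by (simp add: zero_run_const_def)
  with q show "1 \<le> zero_run_const p" by linarith
qed

text \<open>Peeling off the first and dominant term leaves a run of zeros shorter by one that starts
  one position later, hence the induction with \<open>k\<close> arbitrary.\<close>

lemma orbit_sum_zero_run:
  assumes "binary_expansion d x" "x \<in> Sigma_set" "0 < p"
    and "\<forall>i<r. d (Suc (k + i)) = 0" "d (Suc (k + r)) = 1"
  shows "orbit_sum p x (k + r) \<le> orbit_sum p x k + zero_run_const p * 2 powr (p * real r)"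
  using assms(4,5)
proof (induction r arbitrary: k)
  case 0
  then show ?case using zero_run_const_ge[OF assms(3)] by simp
next
  case (Suc r)
  define q where "q = 2 powr p"
  have q: "1 < q" using assms(3) by (simp add: q_def)
  have "orbit_sum p x (Suc k + r) \<le> orbit_sum p x (Suc k) + zero_run_const p * 2 powr (p * real r)"
    using Suc.prems by (intro Suc.IH) auto
  moreover have "1 / ((doubling ^^ k) x) powr p \<le> q * 2 powr (p * real (Suc r))"
    unfolding q_def using orbit_term_bounds(2)[OF assms(1-3) Suc.prems] .
  moreover have "2 powr (p * real (Suc r)) = q * 2 powr (p * real r)"
    by (simp add: q_def algebra_simps powr_add)
  \<comment> \<open>The constant solves \<open>zero_run_const p * (q - 1) = q * q\<close>, so the
    induction closes without loss.\<close>
  moreover have "q * (q * Q) + zero_run_const p * Q = zero_run_const p * (q * Q)" for Q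
    using q unfolding zero_run_const_def q_def[symmetric] by (simp add: field_simps)
  ultimately show ?case
    unfolding add_Suc add_Suc_right orbit_sum_Suc[of p x k] by (smt (verit))
qed

section \<open>The block decomposition, with a fixed digit sequence witnessing it\<close>

locale digit_blocks =
  fixes p x :: real and l m d :: "nat \<Rightarrow> nat"
  assumes p: "0 < p"
    and x: "x \<in> Sigma_set"
    and d: "binary_expansion d x"
    and l_ge: "1 \<le> j \<Longrightarrow> 1 \<le> l j"
    and m_ge: "1 \<le> j \<Longrightarrow> 1 \<le> m j"
    and d_zeros: "1 \<le> j \<Longrightarrow> n \<in> zeros_block l m j \<Longrightarrow> d n = 0"
    and d_ones: "n \<in> ones_block l m j \<Longrightarrow> d n = 1"
begin

abbreviation "s \<equiv> zeros_end l m"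
abbreviation "t \<equiv> ones_end l m"

declare ones_end.simps [simp del]

text \<open>From the second pair of blocks on, this is \<open>Phi1\<close> on the pair
  \<open>j\<close>, and \<open>Psi1\<close> on its zeros. It also makes sense for
  \<open>j = 1\<close>, where \<open>Phi1\<close> is 1 instead, so inductions can start at the first
  zeros.\<close>

definition E :: "nat \<Rightarrow> real" where
  "E j = (\<Sum>u=1..j. 2 powr (p * real (l u))) + (\<Sum>u=1..j-1. real (m u))"

lemma s_le_t: "s j \<le> t j"
  by (simp add: ones_end.simps)

lemma t_less_s: "t j < s (Suc j)"
  using l_ge[of "Suc j"] by simp

lemma t_mono:
  assumes "i \<le> j"
  shows "t i \<le> t j"
proof (rule lift_Suc_mono_le[of t, OF _ assms])
  show "t k \<le> t (Suc k)" for k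
    using t_less_s[of k] s_le_t[of "Suc k"] by linarith
qed

text \<open>Makes the block ends unbounded, so that every position is reached.\<close>

lemma t_ge: "j \<le> t j"
proof (induction j)
  case (Suc j)
  then show ?case using t_less_s[of j] s_le_t[of "Suc j"] by linarith
qed simp

lemma s_less_t: "1 \<le> j \<Longrightarrow> s j < t j"
  using m_ge by (simp add: ones_end.simps Suc_le_eq)

lemma E_ge:
  assumes "1 \<le> j"
  shows "1 \<le> E j"
proof -
  have "1 \<le> 2 powr (p * real (l 1))" using p by (intro ge_one_powr_ge_zero) auto
  also have "\<dots> \<le> (\<Sum>u=1..j. 2 powr (p * real (l u)))"
    using assms by (intro member_le_sum) auto
  also have "\<dots> \<le> E j" unfolding E_def by (simp add: sum_nonneg)
  finally show ?thesis .
qed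

lemma E_Suc_ge: "1 \<le> E (Suc j)"
  by (rule E_ge) simp

text \<open>At \<open>j = 0\<close> the right side would count the initial block of ones, which
  \<open>E\<close> leaves out.\<close>

lemma E_Suc:
  assumes "1 \<le> j"
  shows "E (Suc j) = E j + real (m j) + 2 powr (p * real (l (Suc j)))"
  using assms by (cases j) (auto simp: E_def)

text \<open>Puts the blocks into the offset form of the run estimates; the closing digit 1 exists
  because \<open>m (Suc j)\<close> is at least 1.\<close>

lemma zero_run:
  "\<forall>i<l (Suc j). d (Suc (t j + i)) = 0" "d (Suc (t j + l (Suc j))) = 1"
  using d_zeros[of "Suc j"] d_ones[of _ "Suc j"] m_ge[of "Suc j"]
  by (auto simp: zeros_block_def ones_block_def ones_end.simps)

lemma one_run: "\<forall>i<m j. d (Suc (s j + i)) = 1"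
  using d_ones[of _ j] by (auto simp: ones_block_def ones_end.simps)

section \<open>Orbit sums at the starts and ends of blocks\<close>

lemma block_start_lower:
  "orbit_sum p x (t j) + 2 powr (p * real (l (Suc j))) \<le> orbit_sum p x (Suc (t j))"
  using orbit_term_bounds(1)[OF d x p zero_run[of j]] by (simp add: orbit_sum_Suc)

text \<open>Taking the sum only up to the first zero of a block lets monotonicity carry the bound to
  all later positions of that block and of the ones after it.\<close>

lemma E_le_orbit_sum: "E (Suc j) \<le> orbit_sum p x (Suc (t j))"
proof (induction j)
  case 0
  have "0 \<le> orbit_sum p x (t 0)" by (simp add: orbit_sum_def sum_nonneg)
  then show ?case using block_start_lower[of 0] by (simp add: E_def)
next
  case (Suc j)
  have "orbit_sum p x (Suc (t j)) \<le> orbit_sum p x (s (Suc j))"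
    using t_less_s[of j] by (intro orbit_sum_mono) simp
  then show ?case
    using Suc orbit_sum_one_run(1)[OF d x p one_run[of "Suc j"]] block_start_lower[of "Suc j"]
      E_Suc[of "Suc j"] by (simp add: ones_end.simps)
qed

lemma E_plus_le_orbit_sum: "E (Suc j) + real (m (Suc j)) \<le> orbit_sum p x (t (Suc j))"
proof -
  have "E (Suc j) \<le> orbit_sum p x (s (Suc j))"
    using E_le_orbit_sum[of j] t_less_s[of j] order_trans[OF _ orbit_sum_mono] by (simp add: Suc_le_eq)
  then show ?thesis
    using orbit_sum_one_run(1)[OF d x p one_run[of "Suc j"]] by (simp add: ones_end.simps)
qed

text \<open>Bounds the contribution of the initial ones, which the orbit sum contains but
  \<open>E\<close> does not.\<close>

definition err :: real where "err = 2 powr p * real (m 0)"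

lemma orbit_sum_le_E: "orbit_sum p x (s (Suc j)) \<le> zero_run_const p * E (Suc j) + err"
proof (induction j)
  case 0
  then show ?case
    using orbit_sum_one_run(2)[OF d x p one_run[of 0]] orbit_sum_zero_run[OF d x p zero_run[of 0]]
    by (simp add: E_def err_def ones_end.simps orbit_sum_def)
next
  case (Suc j)
  \<comment> \<open>\<open>zero_run_const p\<close> dominates the cost \<open>2 powr p\<close> of a
    one, so a single constant serves both kinds of block.\<close>
  have "2 powr p * real (m (Suc j)) \<le> zero_run_const p * real (m (Suc j))"
    using zero_run_const_ge[OF p] by (intro mult_right_mono) auto
  then show ?case
    using Suc orbit_sum_one_run(2)[OF d x p one_run[of "Suc j"]]
      orbit_sum_zero_run[OF d x p zero_run[of "Suc j"]] E_Suc[of "Suc j"]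
    by (simp add: ones_end.simps[of l m "Suc j"] distrib_left)
qed

lemma orbit_sum_le_E_plus:
  "orbit_sum p x (t (Suc j)) \<le> zero_run_const p * (E (Suc j) + real (m (Suc j))) + err"
proof -
  have "2 powr p * real (m (Suc j)) \<le> zero_run_const p * real (m (Suc j))"
    using zero_run_const_ge[OF p] by (intro mult_right_mono) auto
  then show ?thesis
    using orbit_sum_le_E[of j] orbit_sum_one_run(2)[OF d x p one_run[of "Suc j"]]
    by (simp add: ones_end.simps[of l m "Suc j"] distrib_left)
qed

section \<open>Locating a position in its block, and the values of \<open>Phi1\<close> and
  \<open>Psi1\<close>\<close>

lemma block_exists:
  assumes "t 1 < n"
  obtains j where "1 \<le> j" "t j < n" "n \<le> t (Suc j)"
proof -
  define k where "k = (LEAST k. n \<le> t k)"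
  have k: "n \<le> t k" unfolding k_def using t_ge[of n] by (rule LeastI)
  have "\<not> k \<le> 1" using k assms t_mono[of k 1] by auto
  then obtain j where j: "k = Suc j" "1 \<le> j" by (cases k) auto
  have "\<not> n \<le> t j" using not_less_Least[of j "\<lambda>k. n \<le> t k"] j by (simp add: k_def)
  then show thesis using that k j by auto
qed

lemma in_block_iff:
  "n \<in> zeros_block l m (Suc j) \<union> ones_block l m (Suc j) \<longleftrightarrow> t j < n \<and> n \<le> t (Suc j)"
  using t_less_s[of j] s_le_t[of "Suc j"] by (auto simp: zeros_block_def ones_block_def)

lemma block_index_eq:
  assumes "t j < n" "n \<le> t (Suc j)"
  shows "block_index l m n = Suc j"
  unfolding block_index_def
proof (rule the_equality)
  show "1 \<le> Suc j \<and> n \<in> zeros_block l m (Suc j) \<union> ones_block l m (Suc j)"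
    using assms in_block_iff by simp
next
  fix i assume i: "1 \<le> i \<and> n \<in> zeros_block l m i \<union> ones_block l m i"
  then obtain k where k: "i = Suc k" by (cases i) auto
  then have tk: "t k < n" "n \<le> t (Suc k)" using i in_block_iff by auto
  \<comment> \<open>If one pair of blocks preceded the other, its end would be at or before the
    start of the other, and \<open>n\<close> could not lie in both.\<close>
  have "\<not> Suc k \<le> j" "\<not> Suc j \<le> k" using t_mono tk assms by (meson leD le_less_trans order_trans)+
  then show "i = Suc j" using k by simp
qed

lemma first_blocks_iff:
  "n \<in> ones_block l m 0 \<union> zeros_block l m 1 \<union> ones_block l m 1 \<longleftrightarrow> 1 \<le> n \<and> n \<le> t 1"
  using t_less_s[of 0] s_le_t[of 1] by (auto simp: zeros_block_def ones_block_def)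

lemma Phi1_first: "1 \<le> n \<Longrightarrow> n \<le> t 1 \<Longrightarrow> Phi1 p l m n = 1"
  and Psi1_first: "1 \<le> n \<Longrightarrow> n \<le> t 1 \<Longrightarrow> Psi1 p l m n = 1"
  using first_blocks_iff[of n] unfolding Phi1_def Psi1_def by simp_all

lemma
  assumes "1 \<le> j" "t j < n" "n \<le> t (Suc j)"
  shows Phi1_eq: "Phi1 p l m n = E (Suc j)"
    and Psi1_eq: "Psi1 p l m n = (if n \<le> s (Suc j) then E (Suc j) else E (Suc j) + real (m (Suc j)))"
proof -
  have "n \<notin> ones_block l m 0 \<union> zeros_block l m 1 \<union> ones_block l m 1"
    unfolding first_blocks_iff using assms t_mono[of 1 j] by auto
  moreover have "n \<in> zeros_block l m (Suc j) \<longleftrightarrow> n \<le> s (Suc j)"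
    using assms by (auto simp: zeros_block_def)
  ultimately show "Phi1 p l m n = E (Suc j)"
    "Psi1 p l m n = (if n \<le> s (Suc j) then E (Suc j) else E (Suc j) + real (m (Suc j)))"
    using block_index_eq[OF assms(2,3)] unfolding Phi1_def Psi1_def E_def by (auto simp: Let_def)
qed

lemma Phi1_ge:
  assumes "1 \<le> n"
  shows "1 \<le> Phi1 p l m n"
proof (cases "n \<le> t 1")
  case False
  then obtain j where "1 \<le> j" "t j < n" "n \<le> t (Suc j)" by (meson block_exists not_le)
  then show ?thesis using Phi1_eq E_Suc_ge[of j] by simp
qed (use assms Phi1_first in simp)

lemma Phi1_le_Psi1:
  assumes "1 \<le> n"
  shows "Phi1 p l m n \<le> Psi1 p l m n"
proof (cases "n \<le> t 1")
  case False
  then obtain j where "1 \<le> j" "t j < n" "n \<le> t (Suc j)" by (meson block_exists not_le)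
  then show ?thesis using Phi1_eq Psi1_eq by simp
qed (use assms Phi1_first Psi1_first in simp)

section \<open>Two-sided estimate of the orbit sum\<close>

lemma Phi1_le_orbit_sum:
  assumes "1 \<le> n"
  shows "Phi1 p l m n \<le> orbit_sum p x n"
proof (cases "n \<le> t 1")
  case True
  \<comment> \<open>On the first blocks \<open>Phi1\<close> is 1, and the first term alone reaches 1
    because \<open>x\<close> lies in (0, 1).\<close>
  have "1 \<le> 1 / x powr p"
    using Sigma_set_bounds[OF x] p by (simp add: powr_le1)
  also have "\<dots> = orbit_sum p x 1" by (simp add: orbit_sum_def)
  also have "\<dots> \<le> orbit_sum p x n" using assms by (rule orbit_sum_mono)
  finally show ?thesis using Phi1_first assms True by simp
next
  case False
  then obtain j where j: "1 \<le> j" "t j < n" "n \<le> t (Suc j)" by (meson block_exists not_le)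
  have "E (Suc j) \<le> orbit_sum p x n"
    using E_le_orbit_sum[of j] orbit_sum_mono[of "Suc (t j)" n p x] j by simp
  then show ?thesis using Phi1_eq j by simp
qed

text \<open>Since \<open>e\<close> is at least 1, the additive error can be absorbed into the
  factor. The summand \<open>orbit_sum p x (t 1)\<close> lets the same constant cover the first
  blocks, where \<open>Psi1\<close> is 1.\<close>

lemma affine_le:
  assumes "1 \<le> e" "y \<le> zero_run_const p * e + err"
  shows "y \<le> (zero_run_const p + err + orbit_sum p x (t 1)) * e"
proof -
  have "0 \<le> err" by (simp add: err_def)
  moreover have "0 \<le> orbit_sum p x (t 1)" by (simp add: orbit_sum_def sum_nonneg)
  ultimately have "err \<le> (err + orbit_sum p x (t 1)) * e"
    using mult_left_mono[OF assms(1), of "err + orbit_sum p x (t 1)"] by simp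
  then show ?thesis using assms(2) by (simp add: algebra_simps)
qed

lemma orbit_sum_le_Psi1:
  assumes "1 \<le> n"
  shows "orbit_sum p x n \<le> (zero_run_const p + err + orbit_sum p x (t 1)) * Psi1 p l m n"
proof (cases "n \<le> t 1")
  case True
  have "0 \<le> err" by (simp add: err_def)
  then show ?thesis
    using Psi1_first[OF assms True] orbit_sum_mono[OF True, of p x] zero_run_const_ge[OF p] by simp
next
  case False
  then obtain j where j: "1 \<le> j" "t j < n" "n \<le> t (Suc j)" by (meson block_exists not_le)
  show ?thesis
  proof (rule affine_le)
    show "1 \<le> Psi1 p l m n" using Phi1_ge Phi1_le_Psi1 assms order_trans by blast
    show "orbit_sum p x n \<le> zero_run_const p * Psi1 p l m n + err"
      using Psi1_eq[OF j] orbit_sum_le_E[of j] orbit_sum_le_E_plus[of j]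
        orbit_sum_mono[of n "s (Suc j)" p x] orbit_sum_mono[OF j(3), of p x]
      by (simp split: if_splits)
  qed
qed

section \<open>Reducing the comparisons to a bound of \<open>m\<close> by \<open>E\<close>\<close>

lemma Psi1_le_Phi1_iff:
  "(\<exists>a>0. \<forall>n\<ge>1. Psi1 p l m n \<le> a * Phi1 p l m n) \<longleftrightarrow> (\<exists>a>0. \<forall>j\<ge>1. real (m (Suc j)) \<le> a * E (Suc j))"
proof
  assume "\<exists>a>0. \<forall>n\<ge>1. Psi1 p l m n \<le> a * Phi1 p l m n"
  then obtain a where a: "a > 0" "\<And>n. n \<ge> 1 \<Longrightarrow> Psi1 p l m n \<le> a * Phi1 p l m n" by blast
  have "real (m (Suc j)) \<le> a * E (Suc j)" if "j \<ge> 1" for j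
  proof -
    have tt: "s (Suc j) < t (Suc j)" "t j < t (Suc j)"
      using t_less_s[of j] s_less_t[of "Suc j"] by auto
    \<comment> \<open>At the end of a block of ones, \<open>Psi1\<close> exceeds \<open>Phi1\<close>
      by the length of the block.\<close>
    have "Psi1 p l m (t (Suc j)) \<le> a * Phi1 p l m (t (Suc j))"
      using tt by (intro a(2)) linarith
    moreover have "Phi1 p l m (t (Suc j)) = E (Suc j)"
      using that tt(2) by (rule Phi1_eq) simp
    moreover have "Psi1 p l m (t (Suc j)) = E (Suc j) + real (m (Suc j))"
      unfolding Psi1_eq[OF that tt(2) order_refl] using tt(1) by (simp only: if_not_P not_le)
    ultimately have "E (Suc j) + real (m (Suc j)) \<le> a * E (Suc j)" by simp
    then show ?thesis using E_Suc_ge[of j] by linarith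
  qed
  then show "\<exists>a>0. \<forall>j\<ge>1. real (m (Suc j)) \<le> a * E (Suc j)" using a(1) by blast
next
  assume "\<exists>a>0. \<forall>j\<ge>1. real (m (Suc j)) \<le> a * E (Suc j)"
  then obtain a where a: "a > 0" "\<And>j. j \<ge> 1 \<Longrightarrow> real (m (Suc j)) \<le> a * E (Suc j)" by blast
  \<comment> \<open>The summand 1 accounts for the common part \<open>E\<close>, and for the first
    blocks, where both functions are 1.\<close>
  have "Psi1 p l m n \<le> (1 + a) * Phi1 p l m n" if "n \<ge> 1" for n
  proof (cases "n \<le> t 1")
    case True
    then show ?thesis using Phi1_first Psi1_first that a(1) by simp
  next
    case False
    then obtain j where j: "1 \<le> j" "t j < n" "n \<le> t (Suc j)" by (meson block_exists not_le)
    have "0 \<le> a * E (Suc j)" using a(1) E_Suc_ge[of j] by simp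
    then show ?thesis
      using a(2)[OF j(1)] unfolding Phi1_eq[OF j] Psi1_eq[OF j] by (simp add: distrib_right)
  qed
  then show "\<exists>a>0. \<forall>n\<ge>1. Psi1 p l m n \<le> a * Phi1 p l m n" using a(1) by (meson add_pos_pos zero_less_one)
qed

text \<open>Tested at the end of a block of ones: the sum has collected the whole length of the
  block, while \<open>Phi1\<close> is still \<open>E (Suc j)\<close>.\<close>

lemma orbit_sum_le_Phi1_imp:
  assumes "0 < b" "\<And>n. n \<ge> 1 \<Longrightarrow> orbit_sum p x n \<le> b * Phi1 p l m n" "1 \<le> j"
  shows "real (m (Suc j)) \<le> b * E (Suc j)"
proof -
  have "t j < t (Suc j)" using t_less_s[of j] s_le_t[of "Suc j"] by linarith
  then have "orbit_sum p x (t (Suc j)) \<le> b * E (Suc j)"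
    using assms(2)[of "t (Suc j)"] Phi1_eq[OF assms(3)] by simp
  then show ?thesis using E_plus_le_orbit_sum[of j] E_Suc_ge[of j] by linarith
qed

lemma Psi1_le_orbit_sum_imp:
  assumes "0 < c" "\<And>n. n \<ge> 1 \<Longrightarrow> c * Psi1 p l m n \<le> orbit_sum p x n" "1 \<le> j"
  shows "real (m (Suc j)) \<le> (zero_run_const p + err + orbit_sum p x (t 1) + 2 powr p) / c * E (Suc j)"
proof -
  \<comment> \<open>At the first position of a block of ones, \<open>\<Psi>\<^sub>1\<close> has already jumped but the sum has not.\<close>
  let ?n = "Suc (s (Suc j))"
  have n: "t j < ?n" "?n \<le> t (Suc j)" using t_less_s[of j] s_less_t[of "Suc j"] by auto
  \<comment> \<open>The single one added here is the source of the summand \<open>2 powr p\<close>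
    in the constant.\<close>
  have "orbit_sum p x ?n \<le> orbit_sum p x (s (Suc j)) + 2 powr p"
    using orbit_sum_one_run(2)[OF d x p, of 1 "s (Suc j)"] zero_run(2)[of j] by simp
  moreover have "orbit_sum p x (s (Suc j)) \<le> (zero_run_const p + err + orbit_sum p x (t 1)) * E (Suc j)"
    using orbit_sum_le_E E_ge by (intro affine_le) auto
  moreover have "2 powr p \<le> 2 powr p * E (Suc j)" using E_Suc_ge[of j] by simp
  moreover have "c * real (m (Suc j)) \<le> c * (E (Suc j) + real (m (Suc j)))"
    using assms(1) E_Suc_ge[of j] by (intro mult_left_mono) auto
  moreover have "c * (E (Suc j) + real (m (Suc j))) \<le> orbit_sum p x ?n"
    using assms(2)[of ?n] Psi1_eq[OF assms(3) n] by simp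
  ultimately have "c * real (m (Suc j)) \<le> (zero_run_const p + err + orbit_sum p x (t 1) + 2 powr p) * E (Suc j)"
    unfolding distrib_right by linarith
  then show ?thesis using assms(1) by (simp add: pos_le_divide_eq mult.commute)
qed

end

section \<open>The equivalences from the block estimates\<close>

theorem theorem3p4:
  fixes p x :: real and l m :: "nat \<Rightarrow> nat"
  assumes "p > 0"
    and "x \<in> Sigma_set"
    and "block_lengths x l m"
  defines "\<Phi> \<equiv> Phi1 p l m"
    and "\<Psi> \<equiv> Psi1 p l m"
    and "S \<equiv> orbit_sum p x"
  defines "A \<equiv> (\<exists>L>0. \<forall>j\<ge>2. real (m j) / ((\<Sum>u=1..j. 2 powr (p * real (l u))) + (\<Sum>u=1..j-1. real (m u))) \<le> L)"
    and "B \<equiv> (\<exists>a>0. \<forall>n\<ge>1. \<Psi> n \<le> a * \<Phi> n)"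
    and "C \<equiv> (\<exists>b1>0. \<exists>b2>0. \<forall>n\<ge>1. b1 * \<Phi> n \<le> S n \<and> S n \<le> b2 * \<Phi> n)"
    and "D \<equiv> (\<exists>c1>0. \<exists>c2>0. \<forall>n\<ge>1. c1 * \<Psi> n \<le> S n \<and> S n \<le> c2 * \<Psi> n)"
  shows "(\<exists>a1>0. \<exists>a2>0. \<forall>n\<ge>1. a1 * \<Phi> n \<le> S n \<and> S n \<le> a2 * \<Psi> n)
    \<and> (A \<longleftrightarrow> B) \<and> (B \<longleftrightarrow> C) \<and> (C \<longleftrightarrow> D)"
proof -
  obtain d where "binary_expansion d x"
    "\<forall>j\<ge>1. \<forall>n \<in> zeros_block l m j. d n = 0" "\<forall>j. \<forall>n \<in> ones_block l m j. d n = 1"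
    using assms(3) unfolding block_lengths_def by blast
  then interpret digit_blocks p x l m d
    using assms(1-3) by unfold_locales (auto simp: block_lengths_def)
  define K where "K = zero_run_const p + err + orbit_sum p x (t 1)"
  have K: "0 < K"
    using zero_run_const_ge[OF p] by (simp add: K_def err_def orbit_sum_def sum_nonneg add_pos_nonneg)
  have low: "\<Phi> n \<le> S n" and up: "S n \<le> K * \<Psi> n" if "1 \<le> n" for n
    using that Phi1_le_orbit_sum orbit_sum_le_Psi1 by (auto simp: \<Phi>_def \<Psi>_def S_def K_def)
  have i: "\<exists>a1>0. \<exists>a2>0. \<forall>n\<ge>1. a1 * \<Phi> n \<le> S n \<and> S n \<le> a2 * \<Psi> n"
    by (intro exI[of _ 1] exI[of _ K] conjI) (use K low up in auto)
  have Bm: "B \<longleftrightarrow> (\<exists>a>0. \<forall>j\<ge>1. real (m (Suc j)) \<le> a * E (Suc j))"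
    unfolding B_def \<Phi>_def \<Psi>_def by (rule Psi1_le_Phi1_iff)
  have "A \<longleftrightarrow> (\<exists>L>0. \<forall>j\<ge>2. real (m j) \<le> L * E j)"
  proof -
    have "real (m j) / E j \<le> L \<longleftrightarrow> real (m j) \<le> L * E j" if "2 \<le> j" for j L
      using E_ge[of j] that by (simp add: pos_divide_le_eq)
    then show ?thesis unfolding A_def E_def[symmetric] by (metis (no_types, lifting))
  qed
  \<comment> \<open>Only a shift of index: \<open>j \<ge> 2\<close> against \<open>Suc j\<close>
    with \<open>j \<ge> 1\<close>.\<close>
  also have "\<dots> \<longleftrightarrow> B"
    unfolding Bm by (metis Suc_1 Suc_le_D Suc_le_mono)
  finally have AB: "A \<longleftrightarrow> B" .
  \<comment> \<open>Under \<open>B\<close>, the bounds \<open>low\<close> and \<open>up\<close> can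
    be rewritten in terms of a single function: the factor \<open>K * a\<close> gives the upper
    bound in \<open>C\<close>, and \<open>1 / a\<close> the lower bound in \<open>D\<close>.\<close>
  have BCD: "C \<and> D" if B
  proof -
    from that obtain a where a: "a > 0" "\<And>n. n \<ge> 1 \<Longrightarrow> \<Psi> n \<le> a * \<Phi> n" unfolding B_def by blast
    have "S n \<le> K * a * \<Phi> n" if "1 \<le> n" for n
      using up[OF that] mult_left_mono[OF a(2)[OF that] less_imp_le[OF K]]
      unfolding mult.assoc by linarith
    then have C unfolding C_def
      by (intro exI[of _ 1] exI[of _ "K * a"] conjI) (use K a low in auto)
    moreover have "1 / a * \<Psi> n \<le> S n" if "1 \<le> n" for n
    proof -
      have "\<Psi> n \<le> a * S n"
        using a(2)[OF that] mult_left_mono[OF low[OF that] less_imp_le[OF a(1)]] by linarith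
      then show ?thesis using a(1) by (simp add: field_simps)
    qed
    then have D unfolding D_def
      by (intro exI[of _ "1 / a"] exI[of _ K] conjI) (use K a up in auto)
    ultimately show ?thesis by blast
  qed
  have CB: B if C
  proof -
    from that obtain b where "b > 0" "\<And>n. n \<ge> 1 \<Longrightarrow> S n \<le> b * \<Phi> n" unfolding C_def by blast
    then show ?thesis unfolding Bm using orbit_sum_le_Phi1_imp unfolding S_def \<Phi>_def by blast
  qed
  have DB: B if D
  proof -
    from that obtain c where c: "c > 0" "\<And>n. n \<ge> 1 \<Longrightarrow> c * \<Psi> n \<le> S n" unfolding D_def by blast
    \<comment> \<open>The constant delivered by \<open>Psi1_le_orbit_sum_imp\<close>; being
      positive, it is a witness for the right side of \<open>Bm\<close>.\<close>
    have "0 < (K + 2 powr p) / c" using K c(1) by (simp add: add_pos_pos)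
    then show ?thesis unfolding Bm using Psi1_le_orbit_sum_imp c
      unfolding S_def \<Psi>_def K_def by blast
  qed
  show ?thesis using i AB BCD CB DB by blast
qed

end
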